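(* Let $(\breve\mu,\breve\alpha,\breve\beta)$ be a unit pure quaternion three-axis system, and let $\breve{\mathbf S}=\mathbf S_0+\mathbf S_1\breve\mu+\mathbf S_2\breve\alpha+\mathbf S_3\breve\beta\in\mathbb Q^{n\times n}$ be a quaternion circulant matrix, where $\mathbf S_0,\mathbf S_1,\mathbf S_2,\mathbf S_3\in\mathbb R^{n\times n}$ are real circulant matrices. Let $\breve{\mathbf F}_{\breve\mu}$ be the $n\times n$ discrete quaternion Fourier transform matrix. Let $\mathbf P$ be the $n\times n$ permutation matrix given by exchanging the $k$-th and $(n-k+3)$-th rows for $k=3,4,\dots,\frac{n+1}{2}$ when $n$ is odd, and by exchanging the $k$-th and $(n-k+3)$-th rows for $k=3,4,\dots,\frac n2$ when $n$ is even. Then $\mathbf P\breve{\mathbf F}_{\breve\mu}$ block-diagonalizes $\breve{\mathbf S}$. More precisely, for odd $n$, $\mathbf P\breve{\mathbf F}_{\breve\mu}\breve{\mathbf S}\breve{\mathbf F}_{\breve\mu}^*\mathbf P^*$ is a block diagonal matrix whose first diagonal block is a $1\times1$ matrix and whose other diagonal blocks are $2\times 2$ matrices; for even $n$, besides diagonal blocks of this kind (a first $1\times 1$ block followed by $2\times 2$ blocks), $\mathbf P\breve{\mathbf F}_{\breve\mu}\breve{\mathbf S}\breve{\mathbf F}_{\breve\mu}^*\mathbf P^*$ has one more $1\times 1$ matrix, located in the last diagonal block.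
   Context: $\mathbb Q$ denotes the real quaternion algebra with units $\mathtt i,\mathtt j,\mathtt k$. A quaternion is pure if its real part is $0$, and unit if its modulus is $1$. Two pure quaternions $\breve\mu=\mu_1\mathtt i+\mu_2\mathtt j+\mu_3\mathtt k$ and $\breve\alpha=\alpha_1\mathtt i+\alpha_2\mathtt j+\alpha_3\mathtt k$ are orthogonal if $\mu_1\alpha_1+\mu_2\alpha_2+\mu_3\alpha_3=0$. A unit pure quaternion three-axis system $(\breve\mu,\breve\alpha,\breve\beta)$ consists of two orthogonal unit pure quaternions $\breve\mu,\breve\alpha$ and their product $\breve\beta=\breve\mu\breve\alpha$. A matrix is circulant if it has the form $\mathrm{circ}(c^{(0)},\dots,c^{(n-1)})$, the $n\times n$ matrix whose $(u,v)$ entry ($u,v=0,\dots,n-1$) is $c^{((u-v)\bmod n)}$. For a unit pure quaternion $\breve\mu$, the $n\times n$ discrete quaternion Fourier transform matrix $\breve{\mathbf F}_{\breve\mu}$ has entries $[\breve{\mathbf F}_{\breve\mu}]_{uv}=\frac1{\sqrt n}\exp\!\left(\frac{-2\pi\breve\mu}{n}\right)^{uv}=\frac{1}{\sqrt n}\left(\cos\frac{2\pi uv}{n}-\breve\mu\sin\frac{2\pi uv}{n}\right)$, $u,v=0,\dots,n-1$. $^*$ denotes the conjugate transpose. Rows in the description of $\mathbf P$ are numbered $1,\dots,n$.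
   Formalization: The row exchanges as stated fail (n=4: P=I, S=αI gives a nonzero entry (2,4) outside the blocks). Here P is instead the permutation matrix that puts the rows in the order 1, 2, n, 3, n−1, 4, n−2, …, so for even n row n/2+1 comes last. *)

theory Defs
  imports "HOL-Analysis.Analysis" "Jordan_Normal_Form.Matrix"
begin

section \<open>The real quaternion algebra\<close>

datatype quat = Quat (Re_q: real) (Im_i: real) (Im_j: real) (Im_k: real)

lemma quat_eq_iff:
  "x = y \<longleftrightarrow> Re_q x = Re_q y \<and> Im_i x = Im_i y \<and> Im_j x = Im_j y \<and> Im_k x = Im_k y"
  by (cases x; cases y) auto

instantiation quat :: ring_1
begin

definition zero_quat :: quat where "0 = Quat 0 0 0 0"
definition one_quat :: quat where "1 = Quat 1 0 0 0"

definition plus_quat :: "quat \<Rightarrow> quat \<Rightarrow> quat" where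
  "x + y = Quat (Re_q x + Re_q y) (Im_i x + Im_i y) (Im_j x + Im_j y) (Im_k x + Im_k y)"

definition uminus_quat :: "quat \<Rightarrow> quat" where
  "- x = Quat (- Re_q x) (- Im_i x) (- Im_j x) (- Im_k x)"

definition minus_quat :: "quat \<Rightarrow> quat \<Rightarrow> quat" where
  "x - y = Quat (Re_q x - Re_q y) (Im_i x - Im_i y) (Im_j x - Im_j y) (Im_k x - Im_k y)"

definition times_quat :: "quat \<Rightarrow> quat \<Rightarrow> quat" where
  "x * y = Quat
     (Re_q x * Re_q y - Im_i x * Im_i y - Im_j x * Im_j y - Im_k x * Im_k y)
     (Re_q x * Im_i y + Im_i x * Re_q y + Im_j x * Im_k y - Im_k x * Im_j y)
     (Re_q x * Im_j y - Im_i x * Im_k y + Im_j x * Re_q y + Im_k x * Im_i y)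
     (Re_q x * Im_k y + Im_i x * Im_j y - Im_j x * Im_i y + Im_k x * Re_q y)"

instance
  by standard (simp_all add: quat_eq_iff zero_quat_def one_quat_def plus_quat_def
      uminus_quat_def minus_quat_def times_quat_def algebra_simps)

end

lemma quat_sel [simp]:
  "Re_q 0 = 0" "Im_i 0 = 0" "Im_j 0 = 0" "Im_k 0 = 0"
  "Re_q 1 = 1" "Im_i 1 = 0" "Im_j 1 = 0" "Im_k 1 = 0"
  "Re_q (x + y) = Re_q x + Re_q y" "Im_i (x + y) = Im_i x + Im_i y"
  "Im_j (x + y) = Im_j x + Im_j y" "Im_k (x + y) = Im_k x + Im_k y"
  "Re_q (- x) = - Re_q x" "Im_i (- x) = - Im_i x"
  "Im_j (- x) = - Im_j x" "Im_k (- x) = - Im_k x"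
  "Re_q (x - y) = Re_q x - Re_q y" "Im_i (x - y) = Im_i x - Im_i y"
  "Im_j (x - y) = Im_j x - Im_j y" "Im_k (x - y) = Im_k x - Im_k y"
  by (simp_all add: zero_quat_def one_quat_def plus_quat_def uminus_quat_def minus_quat_def)

lemma quat_sel_times:
  "Re_q (x * y) = Re_q x * Re_q y - Im_i x * Im_i y - Im_j x * Im_j y - Im_k x * Im_k y"
  "Im_i (x * y) = Re_q x * Im_i y + Im_i x * Re_q y + Im_j x * Im_k y - Im_k x * Im_j y"
  "Im_j (x * y) = Re_q x * Im_j y - Im_i x * Im_k y + Im_j x * Re_q y + Im_k x * Im_i y"
  "Im_k (x * y) = Re_q x * Im_k y + Im_i x * Im_j y - Im_j x * Im_i y + Im_k x * Re_q y"
  by (simp_all add: times_quat_def)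

text \<open>The norm makes the quaternions a Banach algebra, so that the library's \<open>exp\<close> applies.\<close>

instantiation quat :: real_vector
begin

definition scaleR_quat :: "real \<Rightarrow> quat \<Rightarrow> quat" where
  "r *\<^sub>R x = Quat (r * Re_q x) (r * Im_i x) (r * Im_j x) (r * Im_k x)"

instance
  by standard (simp_all add: quat_eq_iff scaleR_quat_def algebra_simps)

end

lemma quat_sel_scaleR [simp]:
  "Re_q (r *\<^sub>R x) = r * Re_q x" "Im_i (r *\<^sub>R x) = r * Im_i x"
  "Im_j (r *\<^sub>R x) = r * Im_j x" "Im_k (r *\<^sub>R x) = r * Im_k x"
  by (simp_all add: scaleR_quat_def)

instantiation quat :: real_inner
begin

definition inner_quat :: "quat \<Rightarrow> quat \<Rightarrow> real" where
  "inner x y = Re_q x * Re_q y + Im_i x * Im_i y + Im_j x * Im_j y + Im_k x * Im_k y"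

definition norm_quat :: "quat \<Rightarrow> real" where
  "norm x = sqrt ((Re_q x)\<^sup>2 + (Im_i x)\<^sup>2 + (Im_j x)\<^sup>2 + (Im_k x)\<^sup>2)"

definition sgn_quat :: "quat \<Rightarrow> quat" where "sgn (x :: quat) = x /\<^sub>R norm x"

definition dist_quat :: "quat \<Rightarrow> quat \<Rightarrow> real" where "dist (x :: quat) y = norm (x - y)"

definition uniformity_quat :: "(quat \<times> quat) filter" where
  "uniformity = (INF e\<in>{0 <..}. principal {(x :: quat, y). dist x y < e})"

definition open_quat :: "quat set \<Rightarrow> bool" where
  "open (U :: quat set) \<longleftrightarrow> (\<forall>x\<in>U. eventually (\<lambda>(x', y). x' = x \<longrightarrow> y \<in> U) uniformity)"

instance
proof
  fix x y z :: quat and r :: real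
  show "inner x y = inner y x" "inner (x + y) z = inner x z + inner y z"
    "inner (r *\<^sub>R x) y = r * inner x y"
    by (simp_all add: inner_quat_def algebra_simps)
  show "0 \<le> inner x x"
    by (simp add: inner_quat_def)
  show "inner x x = 0 \<longleftrightarrow> x = 0"
    by (simp add: inner_quat_def quat_eq_iff add_nonneg_eq_0_iff)
  show "norm x = sqrt (inner x x)"
    by (simp add: inner_quat_def norm_quat_def power2_eq_square)
qed (simp_all add: sgn_quat_def dist_quat_def uniformity_quat_def open_quat_def)

end

instance quat :: real_normed_algebra_1
proof
  fix x y :: quat and r :: real
  show "r *\<^sub>R x * y = r *\<^sub>R (x * y)" "x * r *\<^sub>R y = r *\<^sub>R (x * y)"
    by (simp_all add: quat_eq_iff quat_sel_times algebra_simps)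
  show "norm (1 :: quat) = 1"
    by (simp add: norm_quat_def)
  have "(norm (x * y))\<^sup>2 = (norm x * norm y)\<^sup>2"
    by (simp add: norm_quat_def power_mult_distrib quat_sel_times)
       (simp add: power2_eq_square algebra_simps)
  then have "norm (x * y) = norm x * norm y"
    by (rule power2_eq_imp_eq) (simp_all add: norm_quat_def)
  then show "norm (x * y) \<le> norm x * norm y"
    by (rule eq_refl)
qed

instantiation quat :: euclidean_space
begin

definition Basis_quat :: "quat set" where
  "Basis = {Quat 1 0 0 0, Quat 0 1 0 0, Quat 0 0 1 0, Quat 0 0 0 1}"

instance
proof
  fix x u v :: quat
  show "(Basis :: quat set) \<noteq> {}" "finite (Basis :: quat set)"
    by (simp_all add: Basis_quat_def)
  show "(\<forall>u\<in>Basis. inner x u = 0) \<longleftrightarrow> x = 0"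
    by (simp add: Basis_quat_def inner_quat_def quat_eq_iff[of x 0])
  assume "u \<in> Basis" "v \<in> Basis"
  then show "inner u v = (if u = v then 1 else 0)"
    unfolding Basis_quat_def inner_quat_def by (elim insertE) simp_all
qed

end

definition qcnj :: "quat \<Rightarrow> quat" where
  "qcnj x = Quat (Re_q x) (- Im_i x) (- Im_j x) (- Im_k x)"

definition unit_pure :: "quat \<Rightarrow> bool" where
  "unit_pure x \<longleftrightarrow> Re_q x = 0 \<and> norm x = 1"

definition pure_orthogonal :: "quat \<Rightarrow> quat \<Rightarrow> bool" where
  "pure_orthogonal x y \<longleftrightarrow> Im_i x * Im_i y + Im_j x * Im_j y + Im_k x * Im_k y = 0"

definition three_axis_system :: "quat \<Rightarrow> quat \<Rightarrow> quat \<Rightarrow> bool" where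
  "three_axis_system \<mu> \<alpha> \<beta> \<longleftrightarrow>
     unit_pure \<mu> \<and> unit_pure \<alpha> \<and> pure_orthogonal \<mu> \<alpha> \<and> \<beta> = \<mu> * \<alpha>"

lemma unit_pure_square: "unit_pure \<mu> \<Longrightarrow> \<mu> * \<mu> = - 1"
  by (auto simp: unit_pure_def norm_quat_def quat_eq_iff quat_sel_times power2_eq_square)

lemma exp_unit_pure:
  assumes "unit_pure \<mu>"
  shows "exp (t *\<^sub>R \<mu>) = of_real (cos t) + sin t *\<^sub>R \<mu>"
proof -
  define h where "h z = of_real (Re z) + Im z *\<^sub>R \<mu>" for z
  have lin: "bounded_linear h"
    unfolding h_def
    by (intro bounded_linear_add bounded_linear_compose[OF bounded_linear_of_real bounded_linear_Re]
        bounded_linear_scaleR_const[OF bounded_linear_Im])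
  have mult: "h (y * z) = h y * h z" for y z
    using unit_pure_square[OF assms]
    by (simp add: h_def of_real_def algebra_simps)
  have power: "h (z ^ m) = h z ^ m" for z m
    by (induction m) (simp_all add: mult, simp add: h_def)
  have "(\<lambda>m. h (z ^ m /\<^sub>R fact m)) sums h (exp z)" for z
    by (rule bounded_linear.sums[OF lin exp_converges])
  then have "(\<lambda>m. h z ^ m /\<^sub>R fact m) sums h (exp z)" for z
    by (simp add: linear_cmul[OF bounded_linear.linear[OF lin]] power)
  from sums_unique2[OF exp_converges this]
  have "exp (h (\<i> * of_real t)) = h (exp (\<i> * of_real t))" .
  then show ?thesis
    by (simp add: h_def Re_exp Im_exp)
qed

section \<open>Matrices\<close>

definition circ :: "nat \<Rightarrow> (nat \<Rightarrow> 'a) \<Rightarrow> 'a mat" where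
  "circ n c = mat n n (\<lambda>(u, v). c (nat ((int u - int v) mod int n)))"

definition circulant :: "nat \<Rightarrow> 'a mat \<Rightarrow> bool" where
  "circulant n A \<longleftrightarrow> (\<exists>c. A = circ n c)"

definition scale_quat :: "real mat \<Rightarrow> quat \<Rightarrow> quat mat" where
  "scale_quat A q = map_mat (\<lambda>a. a *\<^sub>R q) A"

definition conj_transpose :: "quat mat \<Rightarrow> quat mat" where
  "conj_transpose A = mat (dim_col A) (dim_row A) (\<lambda>(i, j). qcnj (A $$ (j, i)))"

definition dqft :: "nat \<Rightarrow> quat \<Rightarrow> quat mat" where
  "dqft n \<mu> = mat n n (\<lambda>(u, v).
     (1 / sqrt (real n)) *\<^sub>R exp (- (2 * pi / real n) *\<^sub>R \<mu>) ^ (u * v))"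

lemma dqft_index:
  assumes "unit_pure \<mu>" "u < n" "v < n"
  shows "dqft n \<mu> $$ (u, v) = (1 / sqrt (real n)) *\<^sub>R
    (of_real (cos (2 * pi * real (u * v) / real n)) - sin (2 * pi * real (u * v) / real n) *\<^sub>R \<mu>)"
proof -
  have power: "exp (a *\<^sub>R \<mu>) ^ m = exp ((real m * a) *\<^sub>R \<mu>)" for a m
    by (induction m) (simp_all add: algebra_simps flip: exp_add_commuting)
  have "exp (- (2 * pi / real n) *\<^sub>R \<mu>) ^ (u * v) =
      exp ((- (2 * pi * real (u * v) / real n)) *\<^sub>R \<mu>)"
    unfolding power by (simp add: mult_ac)
  also have "\<dots> = of_real (cos (2 * pi * real (u * v) / real n))
      - sin (2 * pi * real (u * v) / real n) *\<^sub>R \<mu>"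
    by (subst exp_unit_pure[OF assms(1)]) simp
  finally show ?thesis
    using assms by (simp add: dqft_def)
qed

text \<open>
  In this order the rows \<open>1, \<dots>, n\<close> become \<open>1, 2, n, 3, n - 1, 4, n - 2, \<dots>\<close>: each row
  \<open>n - k + 3\<close> with \<open>k \<ge> 3\<close> from the lower half is brought next to row \<open>k - 1\<close>, whose entries
  in the Fourier matrix are the quaternion conjugates of its own; for even \<open>n\<close> the self-conjugate row
  \<open>n div 2 + 1\<close> comes last. Merely transposing the rows \<open>k\<close> and \<open>n - k + 3\<close> does not make
  conjugate rows adjacent (e.g. for \<open>n = 4\<close>, \<open>6\<close>, \<open>7\<close>). Positions and rows are counted from
  \<open>0\<close> below.
\<close>

definition row_order :: "nat \<Rightarrow> nat \<Rightarrow> nat" where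
  "row_order n p = (if odd p then (p + 1) div 2 else (n - p div 2) mod n)"

definition row_perm_mat :: "nat \<Rightarrow> quat mat" where
  "row_perm_mat n = mat n n (\<lambda>(p, u). if u = row_order n p then 1 else 0)"

end

(* Let w be the n-th root of unity exp(-2 pi mu / n). Moving a circulant matrix S cyclically along its
   diagonal does not change it, so every entry q at (a, b) of F S F^* satisfies q = w^a q (w^b)^*, that
   is, q w^b = w^a q. If q is nonzero, then w^a and w^b are conjugate quaternions and have the same
   real part, so a = b or a + b = 0 modulo n. The permutation makes such rows adjacent. *)

theory Submission
  imports Defs
begin

section \<open>Quaternions\<close>

lemma qcnj_mult: "qcnj (x * y) = qcnj y * qcnj x"
  by (simp add: qcnj_def quat_eq_iff quat_sel_times)

text \<open>Multiply by \<open>qcnj q\<close> on the right. The real part of a product is invariant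
  under cyclic rotation of its factors, so \<open>?N\<close>, the squared norm of \<open>q\<close>,
  splits off on both sides.\<close>

lemma Re_q_eq_of_intertwine:
  assumes "q * y = x * q" "q \<noteq> 0"
  shows "Re_q x = Re_q y"
proof -
  let ?N = "(Re_q q)\<^sup>2 + (Im_i q)\<^sup>2 + (Im_j q)\<^sup>2 + (Im_k q)\<^sup>2"
  have "?N * Re_q y = Re_q (q * y * qcnj q)"
    by (simp add: qcnj_def quat_sel_times power2_eq_square algebra_simps)
  also have "\<dots> = ?N * Re_q x"
    unfolding assms(1) by (simp add: qcnj_def quat_sel_times power2_eq_square algebra_simps)
  finally have "?N * Re_q y = ?N * Re_q x" .
  moreover have "?N \<noteq> 0"
    using assms(2) by (auto simp: quat_eq_iff add_nonneg_eq_0_iff)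
  ultimately show ?thesis
    by simp
qed

lemma exp_scaleR_power:
  fixes x :: quat
  shows "exp (a *\<^sub>R x) ^ m = exp ((real m * a) *\<^sub>R x)"
  by (induction m) (simp_all add: algebra_simps flip: exp_add_commuting)

lemma Re_q_of_real [simp]: "Re_q (of_real r) = r"
  by (simp add: of_real_def)

lemma Re_q_exp_unit_pure:
  assumes "unit_pure \<mu>"
  shows "Re_q (exp (t *\<^sub>R \<mu>)) = cos t"
  using assms by (simp add: exp_unit_pure) (simp add: unit_pure_def)

lemma qcnj_exp_unit_pure:
  assumes "unit_pure \<mu>"
  shows "qcnj (exp (t *\<^sub>R \<mu>)) = exp ((- t) *\<^sub>R \<mu>)"
  using assms unfolding exp_unit_pure[OF assms]
  by (simp add: qcnj_def quat_eq_iff of_real_def unit_pure_def)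

section \<open>Entries and dimensions of the matrices involved\<close>

lemma index_mult_mat_sum:
  fixes A B :: "'a :: semiring_0 mat"
  assumes "A \<in> carrier_mat n m" "B \<in> carrier_mat m l" "i < n" "j < l"
  shows "(A * B) $$ (i, j) = (\<Sum>k\<in>{0..<m}. A $$ (i, k) * B $$ (k, j))"
  using assms by (simp add: scalar_prod_def)

lemma conj_transpose_carrier [simp, intro]:
  "A \<in> carrier_mat n m \<Longrightarrow> conj_transpose A \<in> carrier_mat m n"
  by (auto simp: conj_transpose_def)

lemma index_conj_transpose:
  "A \<in> carrier_mat n m \<Longrightarrow> i < m \<Longrightarrow> j < n \<Longrightarrow> conj_transpose A $$ (i, j) = qcnj (A $$ (j, i))"
  by (auto simp: conj_transpose_def)

lemma dqft_carrier [simp]: "dqft n \<mu> \<in> carrier_mat n n"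
  by (simp add: dqft_def)

lemma circ_carrier [simp]: "circ n c \<in> carrier_mat n n"
  by (simp add: circ_def)

lemma row_perm_mat_carrier [simp]: "row_perm_mat n \<in> carrier_mat n n"
  by (simp add: row_perm_mat_def)

lemma row_perm_mat_index:
  "p < n \<Longrightarrow> u < n \<Longrightarrow> row_perm_mat n $$ (p, u) = (if u = row_order n p then 1 else 0)"
  by (simp add: row_perm_mat_def)

section \<open>The transform of a circulant matrix\<close>

text \<open>Entries depend only on the difference of the indices modulo \<open>n\<close>, and
  wrapping around changes an index by a multiple of \<open>n\<close>.\<close>

lemma circ_shift:
  assumes "u < n" "v < n"
  shows "circ n c $$ (Suc u mod n, Suc v mod n) = circ n c $$ (u, v)"
proof -
  have "(int (Suc u mod n) - int (Suc v mod n)) mod int n = (int (Suc u) - int (Suc v)) mod int n"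
    by (simp add: zmod_int mod_diff_eq)
  then show ?thesis
    using assms by (simp add: circ_def)
qed

lemma bij_betw_Suc_mod: "bij_betw (\<lambda>u. Suc u mod n) {0..<n} {0..<n}"
proof (cases n)
  case (Suc m)
  have "inj_on (\<lambda>u. Suc u mod n) {0..<n}"
    using Suc by (auto simp: inj_on_def mod_Suc split: if_splits)
  moreover have "(\<lambda>u. Suc u mod n) ` {0..<n} \<subseteq> {0..<n}"
    using Suc by auto
  ultimately show ?thesis
    by (simp add: bij_betw_def endo_inj_surj)
qed simp

lemma sum_Suc_mod: "(\<Sum>u\<in>{0..<n}. f (Suc u mod n)) = (\<Sum>u\<in>{0..<n}. f u)"
  by (rule sum.reindex_bij_betw[OF bij_betw_Suc_mod])

text \<open>Row \<open>a\<close> is a geometric progression with ratio \<open>w ^ a\<close>; it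
  closes up cyclically because \<open>w ^ n = 1\<close>.\<close>

lemma dqft_shift:
  assumes "unit_pure \<mu>" "a < n" "u < n"
  defines "w \<equiv> exp (- (2 * pi / real n) *\<^sub>R \<mu>)"
  shows "dqft n \<mu> $$ (a, Suc u mod n) = w ^ a * dqft n \<mu> $$ (a, u)"
proof -
  have "w ^ n = exp ((- (2 * pi)) *\<^sub>R \<mu>)"
    using assms(2) unfolding w_def exp_scaleR_power by simp
  also have "\<dots> = 1"
    by (subst exp_unit_pure[OF assms(1)]) simp
  finally have root: "w ^ n = 1" .
  \<comment> \<open>The added factor is 1; it restores the multiple of \<open>n\<close> that
    \<open>mod\<close> took out of the exponent.\<close>
  have "w ^ (a * (Suc u mod n)) = w ^ (a * (Suc u mod n)) * (w ^ n) ^ (a * (Suc u div n))"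
    by (simp add: root)
  also have "\<dots> = w ^ (a * (Suc u mod n) + n * (a * (Suc u div n)))"
    by (simp add: power_add power_mult)
  also have "a * (Suc u mod n) + n * (a * (Suc u div n)) = a * (Suc u mod n + n * (Suc u div n))"
    by (simp only: algebra_simps)
  also have "\<dots> = a + a * u"
    by simp
  finally show ?thesis
    using assms(2,3) by (simp add: dqft_def power_add w_def)
qed

text \<open>The two cosines are the real parts of \<open>w ^ a\<close> and \<open>w ^ b\<close>,
  which a nonzero entry would force to agree.\<close>

lemma transform_entry_eq_0:
  assumes "unit_pure \<mu>" "a < n" "b < n"
    and cos: "cos (2 * pi * real a / real n) \<noteq> cos (2 * pi * real b / real n)"
  shows "(dqft n \<mu> * circ n c * conj_transpose (dqft n \<mu>)) $$ (a, b) = 0"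
proof -
  define w where "w = exp (- (2 * pi / real n) *\<^sub>R \<mu>)"
  let ?F = "dqft n \<mu>"
  define f where "f u v = ?F $$ (a, u) * circ n c $$ (u, v) * qcnj (?F $$ (b, v))" for u v
  define q where "q = (\<Sum>v\<in>{0..<n}. \<Sum>u\<in>{0..<n}. f u v)"
  have entry: "(?F * circ n c * conj_transpose ?F) $$ (a, b) = q"
    using assms(2,3)
    by (simp add: q_def f_def sum_distrib_right index_mult_mat_sum[of _ n n _ n]
        index_conj_transpose[of _ n n] mult_carrier_mat[of _ n n _ n] del: index_mult_mat)
  have shift: "f (Suc u mod n) (Suc v mod n) = w ^ a * f u v * qcnj (w ^ b)"
    if "u < n" "v < n" for u v
    using that assms
    by (simp add: f_def dqft_shift circ_shift w_def qcnj_mult mult.assoc)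
  \<comment> \<open>Shifting both summation indices cyclically leaves the sum unchanged, while by
    \<open>shift\<close> every term gains \<open>w ^ a\<close> on the left and
    \<open>qcnj (w ^ b)\<close> on the right.\<close>
  have "q = (\<Sum>v\<in>{0..<n}. \<Sum>u\<in>{0..<n}. f (Suc u mod n) (Suc v mod n))"
    unfolding q_def sum_Suc_mod[where f = "\<lambda>u. f u _"]
    by (rule sum_Suc_mod[where f = "\<lambda>v. \<Sum>u\<in>{0..<n}. f u v", symmetric])
  also have "\<dots> = w ^ a * q * qcnj (w ^ b)"
    unfolding q_def sum_distrib_left sum_distrib_right by (intro sum.cong refl shift) auto
  finally have q: "q = w ^ a * q * qcnj (w ^ b)" .
  \<comment> \<open>Conjugation reverses the sign of the exponent, so it inverts powers of
    \<open>w\<close>.\<close>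
  have unit: "qcnj (w ^ b) * w ^ b = 1"
    unfolding w_def exp_scaleR_power qcnj_exp_unit_pure[OF assms(1)]
    by (simp flip: exp_add_commuting)
  have "q * w ^ b = w ^ a * q * (qcnj (w ^ b) * w ^ b)"
    by (subst q) (simp only: mult.assoc)
  then have "q * w ^ b = w ^ a * q"
    by (simp add: unit)
  moreover have Re_w: "Re_q (w ^ m) = cos (2 * pi * real m / real n)" for m
  proof -
    have "w ^ m = exp ((- (2 * pi * real m / real n)) *\<^sub>R \<mu>)"
      unfolding w_def exp_scaleR_power by (simp add: mult_ac)
    then show ?thesis
      by (simp only: Re_q_exp_unit_pure[OF assms(1)] cos_minus)
  qed
  ultimately show ?thesis
    using Re_q_eq_of_intertwine[of q "w ^ b" "w ^ a"] cos entry by auto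
qed

section \<open>The permutation of the rows\<close>

lemma row_order_less:
  assumes "p < n"
  shows "row_order n p < n"
  using assms by (auto simp: row_order_def elim!: oddE)

text \<open>For \<open>m > 0\<close>, positions \<open>2 * m - 1\<close> and \<open>2 * m\<close>
  hold rows \<open>m\<close> and \<open>n - m\<close>, whose angles add up to \<open>2 * pi\<close>.
  At position 0 the reduction modulo \<open>n\<close> gives row 0.\<close>

lemma cos_row_order:
  assumes "p < n"
  shows "cos (2 * pi * real (row_order n p) / real n) = cos (2 * pi * real ((p + 1) div 2) / real n)"
proof (cases "odd p \<or> p = 0")
  case False
  then have p: "row_order n p = n - p div 2" "(p + 1) div 2 = p div 2"
    using assms by (auto simp: row_order_def)
  have "2 * pi * real (n - p div 2) / real n = 2 * pi - 2 * pi * real (p div 2) / real n"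
    using assms by (simp add: of_nat_diff field_simps)
  then show ?thesis
    unfolding p by simp
qed (auto simp: row_order_def)

text \<open>The number \<open>(p + 1) div 2\<close> indexes the block containing position
  \<open>p\<close>. Its angle lies between 0 and \<open>pi\<close>, where the cosine is
  injective.\<close>

lemma cos_row_order_eqD:
  assumes "p < n" "q < n"
    and "cos (2 * pi * real (row_order n p) / real n) = cos (2 * pi * real (row_order n q) / real n)"
  shows "(p + 1) div 2 = (q + 1) div 2"
proof -
  have half: "2 * pi * real ((r + 1) div 2) / real n \<le> pi" if "r < n" for r
  proof -
    have "2 * real ((r + 1) div 2) \<le> real n"
      using that by linarith
    then show ?thesis
      using that by (simp add: field_simps)
  qed
  have "2 * pi * real ((p + 1) div 2) / real n = 2 * pi * real ((q + 1) div 2) / real n"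
    using assms(3) unfolding cos_row_order[OF assms(1)] cos_row_order[OF assms(2)]
    by (rule cos_inj_pi[OF _ half[OF assms(1)] _ half[OF assms(2)], rotated 2]) simp_all
  then show ?thesis
    using assms(1) by simp
qed

text \<open>Each row of the permutation matrix has a single 1, so both matrix products collapse to
  one term.\<close>

lemma row_perm_mat_conj_index:
  assumes "M \<in> carrier_mat n n" "p < n" "q < n"
  shows "(row_perm_mat n * M * conj_transpose (row_perm_mat n)) $$ (p, q)
    = M $$ (row_order n p, row_order n q)"
proof -
  let ?P = "row_perm_mat n"
  have PM: "(?P * M) $$ (p, v) = M $$ (row_order n p, v)" if "v < n" for v
    using that assms row_order_less[of p n]
    by (simp add: index_mult_mat_sum[of _ n n _ n] row_perm_mat_def if_distrib[of "\<lambda>x. x * _"]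
        del: index_mult_mat cong: if_cong)
  have qcnj_if: "qcnj (if b then 1 else 0) = (if b then 1 else 0)" for b
    by (simp add: qcnj_def quat_eq_iff)
  have "(?P * M * conj_transpose ?P) $$ (p, q)
      = (\<Sum>v\<in>{0..<n}. (?P * M) $$ (p, v) * qcnj (?P $$ (q, v)))"
    using assms
    by (simp add: index_mult_mat_sum[of "?P * M" n n _ n] index_conj_transpose[of _ n n]
        mult_carrier_mat[of _ n n _ n] del: index_mult_mat)
  also have "\<dots> = (\<Sum>v\<in>{0..<n}. if v = row_order n q then M $$ (row_order n p, v) else 0)"
    using assms by (intro sum.cong) (auto simp: PM row_perm_mat_index qcnj_if simp del: index_mult_mat)
  also have "\<dots> = M $$ (row_order n p, row_order n q)"
    using row_order_less[of q n] assms by simp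
  finally show ?thesis .
qed

section \<open>Block diagonal matrices\<close>

text \<open>The list \<open>ns\<close> holds the block sizes and its prefix sums are the cuts
  between blocks; the hypothesis kills entries whose indices a cut separates. Induction splits off
  the first block.\<close>

lemma diag_block_mat_of_zeros:
  fixes D :: "'a :: zero mat"
  assumes "D \<in> carrier_mat (sum_list ns) (sum_list ns)"
    and "\<And>k p q. p < sum_list (take k ns) \<Longrightarrow> sum_list (take k ns) \<le> q \<Longrightarrow> q < sum_list ns \<Longrightarrow>
      D $$ (p, q) = 0 \<and> D $$ (q, p) = 0"
  shows "\<exists>Bs. list_all2 (\<lambda>B m. B \<in> carrier_mat m m) Bs ns \<and> D = diag_block_mat Bs"
  using assms
proof (induction ns arbitrary: D)
  case Nil
  then show ?case
    by (intro exI[of _ "[]"]) auto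
next
  case (Cons m ns)
  define E where "E = mat (sum_list ns) (sum_list ns) (\<lambda>(p, q). D $$ (m + p, m + q))"
  define A where "A = mat m m (\<lambda>ij. D $$ ij)"
  have "\<exists>Bs. list_all2 (\<lambda>B m. B \<in> carrier_mat m m) Bs ns \<and> E = diag_block_mat Bs"
  proof (rule Cons.IH)
    fix k p q
    assume *: "p < sum_list (take k ns)" "sum_list (take k ns) \<le> q" "q < sum_list ns"
    \<comment> \<open>Cut \<open>k\<close> of the remainder is cut \<open>Suc k\<close> of the whole
      list, moved by \<open>m\<close>.\<close>
    then show "E $$ (p, q) = 0 \<and> E $$ (q, p) = 0"
      using Cons.prems(2)[of "m + p" "Suc k" "m + q"] by (simp add: E_def)
  qed (simp add: E_def)
  then obtain Bs where Bs: "list_all2 (\<lambda>B m. B \<in> carrier_mat m m) Bs ns" "E = diag_block_mat Bs"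
    by blast
  have dims: "dim_row E = sum_list ns" "dim_col E = sum_list ns"
    by (simp_all add: E_def)
  have "D = diag_block_mat (A # Bs)"
  proof (rule eq_matI)
    fix p q
    assume "p < dim_row (diag_block_mat (A # Bs))" "q < dim_col (diag_block_mat (A # Bs))"
    then have pq: "p < m + sum_list ns" "q < m + sum_list ns"
      using dims unfolding Bs(2) by (simp_all add: Let_def A_def)
    \<comment> \<open>Exactly one index lies in the first block, so the cut \<open>Suc 0\<close>
      separates the two.\<close>
    have zeros: "D $$ (p, q) = 0" if "p < m \<longleftrightarrow> \<not> q < m"
      using that pq Cons.prems(2)[of p "Suc 0" q] Cons.prems(2)[of q "Suc 0" p] by auto
    show "D $$ (p, q) = diag_block_mat (A # Bs) $$ (p, q)"
      using pq dims zeros unfolding diag_block_mat.simps Let_def Bs(2)[symmetric]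
      by (auto simp: A_def E_def)
  qed (use Cons.prems(1) dims in \<open>simp_all add: Bs(2) Let_def A_def\<close>)
  moreover have "list_all2 (\<lambda>B m. B \<in> carrier_mat m m) (A # Bs) (m # ns)"
    using Bs(1) by (simp add: A_def)
  ultimately show ?case
    by blast
qed

lemma list_all2_replicate_carrier:
  assumes "list_all2 (\<lambda>B m. B \<in> carrier_mat m m) Bs (replicate k m)"
  shows "set Bs \<subseteq> carrier_mat m m"
  using assms by (auto simp: list_all2_conv_all_nth in_set_conv_nth)


section \<open>Block structure of the permuted transform\<close>

theorem theorem1:
  fixes n :: nat and \<mu> \<alpha> \<beta> :: quat and S :: "quat mat" and S0 S1 S2 S3 :: "real mat"
  assumes "n \<ge> 1"
    and "three_axis_system \<mu> \<alpha> \<beta>"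
    and "circulant n S0" "circulant n S1" "circulant n S2" "circulant n S3"
    and "circulant n S"
    and "S = map_mat of_real S0 + scale_quat S1 \<mu> + scale_quat S2 \<alpha> + scale_quat S3 \<beta>"
  shows
    "let F = dqft n \<mu>; P = row_perm_mat n;
         D = P * F * S * conj_transpose F * conj_transpose P
     in (odd n \<longrightarrow> (\<exists>A Bs. A \<in> carrier_mat 1 1 \<and> set Bs \<subseteq> carrier_mat 2 2 \<and>
           D = diag_block_mat (A # Bs))) \<and>
        (even n \<longrightarrow> (\<exists>A Bs C. A \<in> carrier_mat 1 1 \<and> set Bs \<subseteq> carrier_mat 2 2 \<and>
           C \<in> carrier_mat 1 1 \<and> D = diag_block_mat (A # Bs @ [C])))"
proof -
  let ?F = "dqft n \<mu>" and ?P = "row_perm_mat n"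
  define D where "D = ?P * ?F * S * conj_transpose ?F * conj_transpose ?P"
  obtain c where S: "S = circ n c"
    using assms(7) by (auto simp: circulant_def)
  have \<mu>: "unit_pure \<mu>"
    using assms(2) by (simp add: three_axis_system_def)
  have carrier: "?P \<in> carrier_mat n n" "?F \<in> carrier_mat n n" "S \<in> carrier_mat n n"
    "conj_transpose ?F \<in> carrier_mat n n"
    by (auto simp: S)
  define M where "M = ?F * S * conj_transpose ?F"
  have M: "M \<in> carrier_mat n n"
    unfolding M_def using carrier by (intro mult_carrier_mat)
  have D_M: "D = ?P * M * conj_transpose ?P"
    unfolding D_def M_def using carrier
    by (simp add: assoc_mult_mat[of _ n n _ n _ n] mult_carrier_mat[of _ n n _ n])
  have D_carrier: "D \<in> carrier_mat n n"
    unfolding D_M using carrier(1) M by (intro mult_carrier_mat conj_transpose_carrier)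
  have zero: "D $$ (p, q) = 0" if "p < n" "q < n" "(p + 1) div 2 \<noteq> (q + 1) div 2" for p q
  proof -
    have "D $$ (p, q) = M $$ (row_order n p, row_order n q)"
      unfolding D_M by (rule row_perm_mat_conj_index[OF M that(1,2)])
    also have "\<dots> = 0"
      unfolding M_def S using that cos_row_order_eqD
      by (intro transform_entry_eq_0 \<mu> row_order_less) blast+
    finally show ?thesis .
  qed
  \<comment> \<open>Positions with equal \<open>(p + 1) div 2\<close> are 0 alone and the pairs
    \<open>2 * m - 1\<close>, \<open>2 * m\<close>. An odd cut never falls inside such a pair, and
    cuts at 0 or \<open>n\<close> separate nothing.\<close>
  have blocks: "\<exists>Bs. list_all2 (\<lambda>B m. B \<in> carrier_mat m m) Bs ns \<and> D = diag_block_mat Bs"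
    if n: "sum_list ns = n"
      and odd: "\<And>k. odd (sum_list (take k ns)) \<or> sum_list (take k ns) \<in> {0, n}" for ns
  proof (rule diag_block_mat_of_zeros)
    fix k p q
    assume *: "p < sum_list (take k ns)" "sum_list (take k ns) \<le> q" "q < sum_list ns"
    then have "odd (sum_list (take k ns))"
      using n odd[of k] by (auto simp del: sum_list_eq_0_iff)
    then have "(p + 1) div 2 \<noteq> (q + 1) div 2"
      using *(1,2) by presburger
    then show "D $$ (p, q) = 0 \<and> D $$ (q, p) = 0"
      using * n by (intro conjI zero) auto
  qed (use D_carrier n in simp)
  have "\<exists>A Bs. A \<in> carrier_mat 1 1 \<and> set Bs \<subseteq> carrier_mat 2 2 \<and> D = diag_block_mat (A # Bs)"
    if "odd n"
  proof -
    \<comment> \<open>After the initial 1 every prefix sum is 1 plus an even number, hence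
      odd.\<close>
    define ns where "ns = 1 # replicate (n div 2) (2 :: nat)"
    have "sum_list ns = n"
      using that by (auto simp: ns_def sum_list_replicate elim!: oddE)
    moreover have "odd (sum_list (take k ns)) \<or> sum_list (take k ns) \<in> {0, n}" for k
      by (cases k) (simp_all add: ns_def sum_list_replicate)
    ultimately obtain Bs where "list_all2 (\<lambda>B m. B \<in> carrier_mat m m) Bs ns" "D = diag_block_mat Bs"
      using blocks by blast
    then obtain A Cs where "A \<in> carrier_mat 1 1" "D = diag_block_mat (A # Cs)"
      and Cs: "list_all2 (\<lambda>B m. B \<in> carrier_mat m m) Cs (replicate (n div 2) 2)"
      unfolding ns_def list_all2_Cons2 by blast
    with list_all2_replicate_carrier[OF Cs] show ?thesis
      by blast
  qed
  moreover have "\<exists>A Bs C. A \<in> carrier_mat 1 1 \<and> set Bs \<subseteq> carrier_mat 2 2 \<and> C \<in> carrier_mat 1 1 \<and>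
      D = diag_block_mat (A # Bs @ [C])"
    if "even n"
  proof -
    \<comment> \<open>Here \<open>n\<close> is at least 2, so the subtraction is exact; for
      \<open>n = 2\<close> no pair remains. The final 1 is the position of the self-conjugate row
      \<open>n div 2\<close>.\<close>
    define ns where "ns = 1 # replicate (n div 2 - 1) (2 :: nat) @ [1]"
    have sum: "sum_list ns = n"
      using that assms(1) by (auto simp: ns_def sum_list_replicate elim!: evenE)
    moreover have "odd (sum_list (take k ns)) \<or> sum_list (take k ns) \<in> {0, n}" for k
    \<comment> \<open>A proper prefix omits the final 1, so its sum is 0 or odd; otherwise the
      prefix is all of \<open>ns\<close>.\<close>
    proof (cases "k < length ns")
      case True
      then show ?thesis
        by (cases k) (simp_all add: ns_def sum_list_replicate)
    next
      case False
      then show ?thesis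
        using sum by simp
    qed
    ultimately obtain Bs where "list_all2 (\<lambda>B m. B \<in> carrier_mat m m) Bs ns" "D = diag_block_mat Bs"
      using blocks by blast
    then obtain A Cs C where "A \<in> carrier_mat 1 1" "C \<in> carrier_mat 1 1"
      "D = diag_block_mat (A # Cs @ [C])"
      and Cs: "list_all2 (\<lambda>B m. B \<in> carrier_mat m m) Cs (replicate (n div 2 - 1) 2)"
      unfolding ns_def list_all2_Cons2 list_all2_append2 list_all2_Nil2 by blast
    with list_all2_replicate_carrier[OF Cs] show ?thesis
      by blast
  qed
  ultimately show ?thesis
    unfolding Let_def D_def by blast
qed

end
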